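(* Let $n\ge 2$ and let $C_1,C_2,\ldots,C_n,C_{n+1}=C_1$ be a closed chain of circles in the Euclidean plane such that for each $i=1,\ldots,n$ the circles $C_i$ and $C_{i+1}$ either intersect in two points or touch each other. Let $A_i,B_i$ be the intersection points of $C_i$ and $C_{i+1}$, where $A_i=B_i$ if $C_i$ touches $C_{i+1}$. Let $\varphi_A:=\varphi_{A_n}\circ\cdots\circ\varphi_{A_2}\circ\varphi_{A_1}$ and $\varphi_B:=\varphi_{B_n}\circ\cdots\circ\varphi_{B_2}\circ\varphi_{B_1}$, where $\varphi_{A_i},\varphi_{B_i}:C_i\to C_{i+1}$ are the pivot maps with pivots $A_i$ and $B_i$. If $\varphi_A(X)=X$ holds for one point $X\in C_1$, then $\varphi_B$ is the identity map on $C_1$.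
   Context: Pivot map: let $C,C'$ be two distinct circles which intersect in two points or touch each other, and let $A$ be a common point of $C$ and $C'$. The map $\varphi_A:C\to C'$ is defined as follows. If $X\in C$, $X\ne A$, then $\varphi_A(X)$ is the point of $C'$ such that $X,A,\varphi_A(X)$ are collinear, i.e. the second intersection point of the line $XA$ with $C'$ (equal to $A$ if this line is tangent to $C'$ at $A$). If $X=A$, then $\varphi_A(X)$ is the point of $C'$ such that the line through $A$ and $\varphi_A(X)$ is the tangent to $C$ at $A$, i.e. the second intersection of this tangent with $C'$ (equal to $A$ if $C,C'$ touch at $A$). The point $A$ is called the pivot. If $C$ and $C'$ intersect in two points, then $A_i,B_i$ denote these two distinct points in an arbitrarily chosen order for each $i$. Indices are read cyclically modulo $n$; non-neighbouring circles of the chain are not subject to any condition. *)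

theory Defs
  imports "HOL-Analysis.Analysis"
begin

definition is_circle :: "(real^2) set \<Rightarrow> bool" where
  "is_circle C \<longleftrightarrow> (\<exists>c r. r > 0 \<and> C = sphere c r)"

definition is_line :: "(real^2) set \<Rightarrow> bool" where
  "is_line L \<longleftrightarrow> affine L \<and> aff_dim L = 1"

definition meet_in_two_points :: "(real^2) set \<Rightarrow> (real^2) set \<Rightarrow> bool" where
  "meet_in_two_points C C' \<longleftrightarrow> card (C \<inter> C') = 2"

definition touch :: "(real^2) set \<Rightarrow> (real^2) set \<Rightarrow> bool" where
  "touch C C' \<longleftrightarrow> card (C \<inter> C') = 1"

definition tangent_line :: "(real^2) set \<Rightarrow> real^2 \<Rightarrow> (real^2) set" where
  "tangent_line C A = (THE L. is_line L \<and> L \<inter> C = {A})"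

(* For a line L through a point A of the circle C. It yields A itself when L is tangent to C. *)
definition second_intersection :: "(real^2) set \<Rightarrow> (real^2) set \<Rightarrow> real^2 \<Rightarrow> real^2" where
  "second_intersection L C A = (THE Y. L \<inter> C = {A, Y})"

(* Only meaningful for X on C and a common point A of C and C'. *)
definition pivot_map ::
  "(real^2) set \<Rightarrow> (real^2) set \<Rightarrow> real^2 \<Rightarrow> real^2 \<Rightarrow> real^2" where
  "pivot_map C C' A X =
     second_intersection (if X = A then tangent_line C A else affine hull {X, A}) C' A"

(* The maps are numbered from 1: the k-th one goes from C k to C (k + 1) with pivot P k. *)
primrec pivot_chain ::
  "(nat \<Rightarrow> (real^2) set) \<Rightarrow> (nat \<Rightarrow> real^2) \<Rightarrow> nat \<Rightarrow> real^2 \<Rightarrow> real^2" where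
  "pivot_chain C P 0 = id"
| "pivot_chain C P (Suc k) =
     pivot_map (C (Suc k)) (C (Suc (Suc k))) (P (Suc k)) \<circ> pivot_chain C P k"

end

theory Submission
  imports Defs
begin

text \<open>
  Identify the plane with the complex numbers and describe a point of a circle by its position
  relative to the centre. If the common point of two circles has relative positions \<open>a\<close> and
  \<open>a'\<close>, the pivot map is multiplication by the conjugate of \<open>a' / a\<close>. The other common
  point is the mirror image of the first in the line of centres, so its multiplier is the complex
  conjugate. Hence the products of the multipliers around the chain are conjugate as well: a fixed
  point of the first chain forces the first product, and therefore the second, to be 1.
\<close>

section \<open>Complex coordinates for vectors of the plane\<close>

definition cx :: "real^2 \<Rightarrow> complex" where
  "cx v = Complex (v $ 1) (v $ 2)"

lemma cx_diff: "cx (v - w) = cx v - cx w"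
  by (simp add: cx_def complex_eq_iff)

lemma cx_scaleR: "cx (t *\<^sub>R v) = of_real t * cx v"
  by (simp add: cx_def complex_eq_iff)

lemma cx_eq_iff: "cx v = cx w \<longleftrightarrow> v = w"
  by (auto simp: cx_def vec_eq_iff forall_2)

lemma cx_0 [simp]: "cx 0 = 0"
  by (simp add: cx_def complex_eq_iff)

lemma cx_eq_0_iff: "cx v = 0 \<longleftrightarrow> v = 0"
  using cx_eq_iff[of v 0] by simp

text \<open>Both sides are twice the real part of \<open>cx v * cnj (cx w)\<close>; the doubling
  avoids a division and matches the coefficient \<open>2 * (d \<bullet> (A - c))\<close> of the
  chord formula.\<close>

lemma inner_cx: "of_real (2 * (v \<bullet> w)) = cx v * cnj (cx w) + cnj (cx v) * cx w"
  by (simp add: cx_def complex_eq_iff inner_vec_def sum_2)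

lemma inner_self_cx: "of_real (v \<bullet> v) = cx v * cnj (cx v)"
  by (simp add: cx_def complex_eq_iff inner_vec_def sum_2)

lemma mem_sphere_inner:
  assumes "r > 0"
  shows "v \<in> sphere c r \<longleftrightarrow> (v - c) \<bullet> (v - c) = r\<^sup>2"
  using assms by (metis dist_commute dist_norm dot_square_norm less_imp_le mem_sphere norm_ge_zero
      power2_eq_iff_nonneg)

lemma cmod_cx: "cmod (cx v) = norm v"
  by (simp add: norm_vec_def L2_set_def sum_2 cx_def cmod_def)

lemma mem_sphere_cx: "v \<in> sphere c r \<longleftrightarrow> cmod (cx (v - c)) = r"
  by (metis cmod_cx dist_commute dist_norm mem_sphere)

section \<open>Lines through a point of a circle: chords and tangents\<close>

lemma is_line_imp_range:
  assumes "is_line L" "A \<in> L"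
  obtains d where "d \<noteq> 0" "L = range (\<lambda>t. A + t *\<^sub>R d)"
proof -
  have "L \<noteq> {A}"
    using assms(1) by (auto simp: is_line_def)
  then obtain Q where Q: "Q \<in> L" "Q \<noteq> A"
    using assms(2) by blast
  have "affine hull {A, Q} \<subseteq> L"
    using assms Q by (intro hull_minimal) (auto simp: is_line_def)
  then have "L = affine hull {A, Q}"
    using assms(1) Q(2) affine_dim_equal[of "affine hull {A, Q}" L]
    by (auto simp: is_line_def aff_dim_2)
  with Q(2) show thesis
    using that[of "Q - A"] affine_hull_2_alt[of A Q] by simp
qed

lemma is_line_range:
  assumes "d \<noteq> 0"
  shows "is_line (range (\<lambda>t. A + t *\<^sub>R d))"
  using assms affine_hull_2_alt[of A "A + d"] aff_dim_2[of A "A + d"]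
    affine_affine_hull[of "{A, A + d}"] aff_dim_affine_hull[of "{A, A + d}"]
  by (simp add: is_line_def)

text \<open>Substituting \<open>A + t *\<^sub>R d\<close> into the equation of the circle gives a
  quadratic in \<open>t\<close> with root 0, since \<open>A\<close> lies on the circle, so the other
  root is rational in the data. The roots coincide when \<open>d\<close> is orthogonal to the
  radius, hence secants and tangents share one formula.\<close>

lemma line_inter_sphere:
  fixes d :: "real^2"
  assumes "r > 0" "A \<in> sphere c r" "d \<noteq> 0"
  shows "range (\<lambda>t. A + t *\<^sub>R d) \<inter> sphere c r
      = {A, A - (2 * (d \<bullet> (A - c)) / (d \<bullet> d)) *\<^sub>R d}"
proof -
  have dd: "d \<bullet> d \<noteq> 0"
    using assms by simp
  have a: "(A - c) \<bullet> (A - c) = r\<^sup>2"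
    using assms mem_sphere_inner by blast
  have "A + t *\<^sub>R d \<in> sphere c r \<longleftrightarrow> t = 0 \<or> t = - (2 * (d \<bullet> (A - c)) / (d \<bullet> d))" for t
  proof -
    have "A + t *\<^sub>R d \<in> sphere c r
        \<longleftrightarrow> ((A - c) + t *\<^sub>R d) \<bullet> ((A - c) + t *\<^sub>R d) = (A - c) \<bullet> (A - c)"
      unfolding mem_sphere_inner[OF assms(1)] a by (simp add: diff_add_eq)
    also have "\<dots> \<longleftrightarrow> t * (2 * (d \<bullet> (A - c)) + t * (d \<bullet> d)) = 0"
      by (simp add: inner_add_left inner_add_right inner_commute algebra_simps)
    also have "\<dots> \<longleftrightarrow> t = 0 \<or> t = - (2 * (d \<bullet> (A - c)) / (d \<bullet> d))"
      using dd
      by (simp add: add_eq_0_iff eq_divide_eq minus_divide_left del: minus_divide_left[symmetric])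
    finally show ?thesis .
  qed
  note * = this
  show ?thesis
  proof (intro equalityI subsetI)
    fix v assume "v \<in> range (\<lambda>t. A + t *\<^sub>R d) \<inter> sphere c r"
    then obtain t where "v = A + t *\<^sub>R d" "t = 0 \<or> t = - (2 * (d \<bullet> (A - c)) / (d \<bullet> d))"
      using * by blast
    then show "v \<in> {A, A - (2 * (d \<bullet> (A - c)) / (d \<bullet> d)) *\<^sub>R d}"
      by auto
  next
    fix v assume v: "v \<in> {A, A - (2 * (d \<bullet> (A - c)) / (d \<bullet> d)) *\<^sub>R d}"
    then obtain t where "v = A + t *\<^sub>R d" "t = 0 \<or> t = - (2 * (d \<bullet> (A - c)) / (d \<bullet> d))"
      by (metis add.right_neutral diff_conv_add_uminus insertE scaleR_minus_left scaleR_zero_left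
          singletonD)
    with * show "v \<in> range (\<lambda>t. A + t *\<^sub>R d) \<inter> sphere c r"
      by blast
  qed
qed

lemma second_intersection_range:
  fixes d :: "real^2"
  assumes "r > 0" "A \<in> sphere c r" "d \<noteq> 0"
  shows "second_intersection (range (\<lambda>t. A + t *\<^sub>R d)) (sphere c r) A
      = A - (2 * (d \<bullet> (A - c)) / (d \<bullet> d)) *\<^sub>R d"
  unfolding second_intersection_def line_inter_sphere[OF assms]
  \<comment> \<open>The set \<open>{A, Y}\<close> determines \<open>Y\<close> even in the tangent
    case \<open>Y = A\<close>.\<close>
  by (rule the_equality) (auto simp: doubleton_eq_iff)

text \<open>This justifies the definite description: a line meets the circle only in
  \<open>A\<close> when the second root vanishes, i.e. when its direction is orthogonal to the
  radius, and in the plane this fixes the direction up to scaling.\<close>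

lemma tangent_line_range:
  assumes "r > 0" "A \<in> sphere c r"
  obtains d where "d \<noteq> 0" "d \<bullet> (A - c) = 0"
    "tangent_line (sphere c r) A = range (\<lambda>t. A + t *\<^sub>R d)"
proof -
  define a where "a = A - c"
  \<comment> \<open>The radius turned by a right angle.\<close>
  define d :: "real^2" where "d = vector [- (a $ 2), a $ 1]"
  have "a \<noteq> 0"
    using assms by (auto simp: a_def)
  then have d: "d \<noteq> 0"
    by (auto simp: d_def vec_eq_iff forall_2)
  have perp: "d \<bullet> a = 0"
    by (simp add: d_def inner_vec_def sum_2)
  have unique: "L = range (\<lambda>t. A + t *\<^sub>R d)" if L: "is_line L" "L \<inter> sphere c r = {A}" for L
  proof -
    obtain e where e: "e \<noteq> 0" "L = range (\<lambda>t. A + t *\<^sub>R e)"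
      using is_line_imp_range[of L A] L by blast
    have "A - (2 * (e \<bullet> (A - c)) / (e \<bullet> e)) *\<^sub>R e = A"
      using L(2) line_inter_sphere[OF assms e(1)] e(2) by blast
    then have "e \<bullet> a = 0"
      using e(1) by (simp add: a_def)
    then have orth: "e $ 1 * a $ 1 + e $ 2 * a $ 2 = 0"
      by (simp add: inner_vec_def sum_2)
    define s where "s = (e \<bullet> d) / (d \<bullet> d)"
    \<comment> \<open>As \<open>e\<close> and \<open>d\<close> are both orthogonal to
      \<open>a\<close>, \<open>e\<close> equals its projection onto \<open>d\<close>.\<close>
    have "(d \<bullet> d) *\<^sub>R e = (e \<bullet> d) *\<^sub>R d"
      using orth unfolding vec_eq_iff forall_2
      by (simp add: d_def inner_vec_def sum_2) algebra
    then have s: "e = s *\<^sub>R d"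
      using d by (simp add: s_def vec_eq_iff field_simps)
    then have "s \<noteq> 0"
      using e(1) by auto
    then have "A + t *\<^sub>R d = A + (t / s) *\<^sub>R e" for t
      by (simp add: s)
    moreover have "A + t *\<^sub>R e = A + (t * s) *\<^sub>R d" for t
      by (simp add: s)
    ultimately show ?thesis
      unfolding e(2) by blast
  qed
  have "range (\<lambda>t. A + t *\<^sub>R d) \<inter> sphere c r = {A}"
    using line_inter_sphere[OF assms d] perp by (simp add: a_def)
  then have "tangent_line (sphere c r) A = range (\<lambda>t. A + t *\<^sub>R d)"
    unfolding tangent_line_def using unique is_line_range[OF d] by (intro the_equality) auto
  then show thesis
    using that d perp a_def by blast
qed

section \<open>The pivot map as multiplication by a complex number\<close>

lemma cx_reflection:
  assumes "d \<noteq> 0"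
  shows "cx d * cnj (cx d) * cx (A - (2 * (d \<bullet> (A - c)) / (d \<bullet> d)) *\<^sub>R d - c)
      = - (cx d)\<^sup>2 * cnj (cx (A - c))"
proof -
  \<comment> \<open>Passing to the other end of the chord reflects \<open>A - c\<close> in the
    perpendicular to \<open>d\<close> through the centre, in complex terms \<open>z\<close> to
    \<open>- (d / cnj d) * cnj z\<close>; everything is multiplied by \<open>d \<bullet> d\<close>,
    which is \<open>cx d * cnj (cx d)\<close>.\<close>
  have "d \<bullet> d \<noteq> 0"
    using assms by simp
  then have "(d \<bullet> d) *\<^sub>R (A - (2 * (d \<bullet> (A - c)) / (d \<bullet> d)) *\<^sub>R d - c)
      = (d \<bullet> d) *\<^sub>R (A - c) - (2 * (d \<bullet> (A - c))) *\<^sub>R d"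
    by (simp add: scaleR_diff_right)
  then have "cx ((d \<bullet> d) *\<^sub>R (A - (2 * (d \<bullet> (A - c)) / (d \<bullet> d)) *\<^sub>R d - c))
      = cx ((d \<bullet> d) *\<^sub>R (A - c) - (2 * (d \<bullet> (A - c))) *\<^sub>R d)"
    by simp
  then show ?thesis
    unfolding cx_scaleR inner_self_cx cx_diff[of "_ *\<^sub>R _"] inner_cx
    by (simp add: algebra_simps power2_eq_square)
qed

lemma pivot_map_sphere:
  assumes "r > 0" "A \<in> sphere c r" "s > 0" "A \<in> sphere c' s" "X \<in> sphere c r"
  shows "pivot_map (sphere c r) (sphere c' s) A X \<in> sphere c' s" (is ?mem)
    and "cx (pivot_map (sphere c r) (sphere c' s) A X - c')
      = cnj (cx (A - c') / cx (A - c)) * cx (X - c)" (is ?mult)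
proof -
  define L where "L = (if X = A then tangent_line (sphere c r) A else affine hull {X, A})"
  \<comment> \<open>In both cases of the definition \<open>X\<close> is the second intersection of
    \<open>L\<close> with the first circle; for \<open>X = A\<close> the direction is tangent and
    the coefficient vanishes.\<close>
  obtain d where d: "d \<noteq> 0" "L = range (\<lambda>t. A + t *\<^sub>R d)"
    and X: "X = A - (2 * (d \<bullet> (A - c)) / (d \<bullet> d)) *\<^sub>R d"
  proof (cases "X = A")
    case True
    obtain e where e: "e \<noteq> 0" "e \<bullet> (A - c) = 0"
      "tangent_line (sphere c r) A = range (\<lambda>t. A + t *\<^sub>R e)"
      using tangent_line_range[OF assms(1,2)] by blast
    show thesis
      by (rule that[OF e(1)]) (simp_all add: L_def True e(2,3))
  next
    case False
    have L: "L = range (\<lambda>t. A + t *\<^sub>R (X - A))"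
      using False affine_hull_2_alt[of A X] by (simp add: L_def insert_commute)
    have "X \<in> L"
      using False by (simp add: L_def hull_inc)
    with assms(5) have "X \<in> range (\<lambda>t. A + t *\<^sub>R (X - A)) \<inter> sphere c r"
      using L by blast
    moreover have ne: "X - A \<noteq> 0"
      using False by simp
    ultimately have "X = A - (2 * ((X - A) \<bullet> (A - c)) / ((X - A) \<bullet> (X - A))) *\<^sub>R (X - A)"
      unfolding line_inter_sphere[OF assms(1,2) ne] using False by blast
    then show thesis
      by (rule that[OF ne L])
  qed
  define Y where "Y = pivot_map (sphere c r) (sphere c' s) A X"
  have Y: "Y = A - (2 * (d \<bullet> (A - c')) / (d \<bullet> d)) *\<^sub>R d"
    unfolding Y_def pivot_map_def L_def[symmetric] d(2)
    by (rule second_intersection_range[OF assms(3,4) d(1)])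
  show ?mem
    using line_inter_sphere[OF assms(3,4) d(1), folded Y] unfolding Y_def by blast
  define a a' where "a = cx (A - c)" and "a' = cx (A - c')"
  have a: "a \<noteq> 0"
    using assms(1,2) by (auto simp: a_def cx_eq_0_iff)
  have nz: "cx d * cnj (cx d) \<noteq> 0"
    using d(1) by (simp add: cx_eq_0_iff)
  have "cx d * cnj (cx d) * cx (Y - c') = - (cx d)\<^sup>2 * cnj a'"
    and "cx d * cnj (cx d) * cx (X - c) = - (cx d)\<^sup>2 * cnj a"
    using cx_reflection[OF d(1), of A c', folded Y] cx_reflection[OF d(1), of A c, folded X]
    by (simp_all only: a_def a'_def)
  \<comment> \<open>The point and its image arise from reflections with the same \<open>d\<close>;
    cross-multiplying removes the factor that depends on the line, so the multiplier depends only on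
    \<open>A\<close> and the centres.\<close>
  then have "cx d * cnj (cx d) * (cx (Y - c') * cnj a) = cx d * cnj (cx d) * (cnj a' * cx (X - c))"
    by algebra
  then have "cx (Y - c') * cnj a = cnj a' * cx (X - c)"
    using nz by simp
  then show ?mult
    using a by (simp add: field_simps Y_def a_def a'_def)
qed

section \<open>The two common points of neighbouring circles\<close>

lemma infinite_sphere_2:
  fixes c :: "real^2"
  assumes "r > 0"
  shows "infinite (sphere c r)"
proof
  assume "finite (sphere c r)"
  moreover have "connected (sphere c r)"
    by (rule connected_sphere) simp
  ultimately have "sphere c r = {} \<or> (\<exists>x. sphere c r = {x})"
    by (simp add: connected_finite_iff_sing)
  \<comment> \<open>The ends of a diameter are two points, too many for a finite connected
    set.\<close>
  moreover have "c + axis 1 r \<in> sphere c r" "c - axis 1 r \<in> sphere c r"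
    using assms by (simp_all add: dist_norm norm_vec_def L2_set_def sum_2 axis_def)
  moreover have "c + axis 1 r \<noteq> c - axis 1 r"
    using assms by (auto simp: vec_eq_iff axis_def)
  ultimately show False
    by (metis empty_iff singletonD)
qed

text \<open>Reflection in the line of centres takes \<open>a\<close> to \<open>b\<close> and fixes
  \<open>e\<close>, hence takes \<open>a - e\<close> to \<open>b - e\<close>. It is conjugation
  followed by multiplication by \<open>e / cnj e\<close>, and this factor cancels in the
  quotient.\<close>

lemma conjugate_multipliers:
  assumes "r > 0" "s > 0" and AB: "sphere c r \<inter> sphere c' s = {A, B}"
  shows "cx (B - c') / cx (B - c) = cnj (cx (A - c') / cx (A - c))"
proof -
  define e a b where "e = cx (c' - c)" and "a = cx (A - c)" and "b = cx (B - c)"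
  have mem: "A \<in> sphere c r" "A \<in> sphere c' s" "B \<in> sphere c r" "B \<in> sphere c' s"
    using AB by auto
  \<comment> \<open>Concentric circles with a common point coincide and so share infinitely many
    points.\<close>
  have ne: "c \<noteq> c'"
  proof
    assume "c = c'"
    with mem have "sphere c r = sphere c' s"
      by auto
    with AB infinite_sphere_2[OF assms(1), of c] show False
      by simp
  qed
  then have e: "e \<noteq> 0"
    by (simp add: e_def cx_eq_0_iff)
  have a: "a \<noteq> 0" "cmod a = r" "cmod (a - e) = s" and b: "cmod b = r" "cmod (b - e) = s"
    using mem assms(1) unfolding mem_sphere_cx by (auto simp: a_def b_def e_def cx_diff)
  have ab: "b * cnj e = e * cnj a"
  proof (cases "A = B")
    case True
    \<comment> \<open>\<open>w\<close> is the mirror image of \<open>a\<close>. The corresponding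
      point \<open>R\<close> lies on both circles, so in the touching case it is the only common
      point.\<close>
    define w where "w = e * cnj a / cnj e"
    define R where "R = c + vector [Re w, Im w]"
    have R: "cx (R - c) = w"
      by (simp add: R_def cx_def)
    have "w - e = e * cnj (a - e) / cnj e"
      using e by (simp add: w_def diff_divide_distrib right_diff_distrib)
    then have "cmod (w - e) = cmod (a - e)"
      using e by (simp only: norm_mult norm_divide complex_mod_cnj) simp
    moreover have "cmod w = cmod a"
      using e by (simp add: w_def norm_mult norm_divide)
    moreover have "cx (R - c') = w - e"
      unfolding R[symmetric] by (simp add: e_def cx_diff)
    ultimately have "R \<in> sphere c r \<inter> sphere c' s"
      unfolding Int_iff mem_sphere_cx using R a by simp
    then have "R = B"
      using AB True by auto
    then show ?thesis
      using R e by (simp add: b_def w_def)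
  next
    case False
    \<comment> \<open>Multiplying by \<open>cnj e\<close> turns the line of centres into the real
      axis. The two circle equations then say that \<open>p\<close> and \<open>q\<close> have equal
      modulus and equal real part.\<close>
    define p q where "p = a * cnj e" and "q = b * cnj e"
    have "p \<noteq> q"
      using False e by (simp add: p_def q_def a_def b_def cx_diff cx_eq_iff)
    have norms: "a * cnj a = b * cnj b" "(a - e) * cnj (a - e) = (b - e) * cnj (b - e)"
      using a b by (simp_all only: complex_norm_square[symmetric])
    have "p * cnj p = q * cnj q"
      using norms(1) unfolding p_def q_def complex_cnj_mult complex_cnj_cnj by algebra
    moreover have "p + cnj p = q + cnj q"
      using norms unfolding p_def q_def complex_cnj_mult complex_cnj_cnj complex_cnj_diff
      by algebra
    \<comment> \<open>\<open>q\<close> is a root of the quadratic with roots \<open>p\<close> and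
      \<open>cnj p\<close>.\<close>
    ultimately have "(q - p) * (q - cnj p) = 0"
      by algebra
    with \<open>p \<noteq> q\<close> show ?thesis
      by (auto simp: p_def q_def mult.commute)
  qed
  have "b \<noteq> 0"
    using b assms(1) by auto
  moreover have "(b - e) * cnj a * cnj e = b * cnj (a - e) * cnj e"
    using ab by (simp add: algebra_simps)
  ultimately have "(b - e) / b = cnj ((a - e) / a)"
    using a(1) e by (simp add: frac_eq_eq)
  then show ?thesis
    by (simp add: a_def b_def e_def cx_diff)
qed

section \<open>Composition along the chain\<close>

lemma pivot_chain_multiplier:
  assumes "\<And>i. i \<in> {1..n + 1} \<Longrightarrow> r i > 0 \<and> C i = sphere (c i) (r i)"
    and "\<And>i. i \<in> {1..n} \<Longrightarrow> P i \<in> C i \<inter> C (i + 1)"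
    and "X \<in> C 1" "k \<le> n"
  shows "pivot_chain C P k X \<in> C (k + 1) \<and>
    cx (pivot_chain C P k X - c (k + 1))
      = (\<Prod>i=1..k. cnj (cx (P i - c (i + 1)) / cx (P i - c i))) * cx (X - c 1)"
  using assms(4)
\<comment> \<open>Membership is carried along because the multiplier rule for the next pivot map
  requires its argument to lie on the current circle.\<close>
proof (induction k)
  case 0
  then show ?case
    using assms(3) by simp
next
  case (Suc k)
  define Y where "Y = pivot_chain C P k X"
  have IH: "Y \<in> C (Suc k)" "cx (Y - c (Suc k))
      = (\<Prod>i=1..k. cnj (cx (P i - c (i + 1)) / cx (P i - c i))) * cx (X - c 1)"
    using Suc by (simp_all add: Y_def)
  have C: "r (Suc k) > 0" "C (Suc k) = sphere (c (Suc k)) (r (Suc k))"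
    "r (Suc (Suc k)) > 0" "C (Suc (Suc k)) = sphere (c (Suc (Suc k))) (r (Suc (Suc k)))"
    using assms(1)[of "Suc k"] assms(1)[of "Suc (Suc k)"] Suc.prems by auto
  have P: "P (Suc k) \<in> C (Suc k)" "P (Suc k) \<in> C (Suc (Suc k))"
    using assms(2)[of "Suc k"] Suc.prems by auto
  show ?case
    using pivot_map_sphere[OF C(1) P(1)[unfolded C(2)] C(3) P(2)[unfolded C(4)] IH(1)[unfolded C(2)],
        folded C(2,4)] IH(2)
    by (simp add: Y_def)
qed

theorem theorem3:
  fixes n :: nat and C :: "nat \<Rightarrow> (real^2) set" and A B :: "nat \<Rightarrow> real^2" and X :: "real^2"
  assumes "n \<ge> 2"
    and "\<forall>i\<in>{1..n}. is_circle (C i)"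
    and "C (n + 1) = C 1"
    and "\<forall>i\<in>{1..n}. meet_in_two_points (C i) (C (i + 1)) \<or> touch (C i) (C (i + 1))"
    and "\<forall>i\<in>{1..n}. C i \<inter> C (i + 1) = {A i, B i}"
    and "X \<in> C 1"
    and "pivot_chain C A n X = X"
  shows "\<forall>Y\<in>C 1. pivot_chain C B n Y = Y"
proof
  fix Y assume Y: "Y \<in> C 1"
  \<comment> \<open>Centre and radius are chosen per circle rather than per index, so that
    \<open>C (n + 1) = C 1\<close> yields \<open>c (n + 1) = c 1\<close>.\<close>
  have "\<forall>S. \<exists>c r. is_circle S \<longrightarrow> r > 0 \<and> S = sphere c r"
    unfolding is_circle_def by blast
  then obtain ctr rad where *: "\<And>S. is_circle S \<Longrightarrow> rad S > 0 \<and> S = sphere (ctr S) (rad S)"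
    unfolding choice_iff by blast
  define c r where "c = (\<lambda>i. ctr (C i))" and "r = (\<lambda>i. rad (C i))"
  have circle: "r i > 0 \<and> C i = sphere (c i) (r i)" if "i \<in> {1..n + 1}" for i
  proof -
    have "is_circle (C i)"
      using assms(1,2,3) that by (cases "i = n + 1") auto
    then show ?thesis
      using * by (simp add: c_def r_def)
  qed
  have cyc: "c (n + 1) = c 1"
    unfolding c_def assms(3) ..
  define M where "M P = (\<Prod>i=1..n. cnj (cx (P i - c (i + 1)) / cx (P i - c i)))" for P
  have common: "A i \<in> C i \<inter> C (i + 1)" "B i \<in> C i \<inter> C (i + 1)" if "i \<in> {1..n}" for i
    using assms(5) that by blast+
  have A: "cx (pivot_chain C A n X - c 1) = M A * cx (X - c 1)"
    using pivot_chain_multiplier[of n r C c A X n, OF circle common(1) assms(6) le_refl]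
    unfolding M_def cyc by blast
  have B: "cx (pivot_chain C B n Y - c 1) = M B * cx (Y - c 1)"
    using pivot_chain_multiplier[of n r C c B Y n, OF circle common(2) Y le_refl]
    unfolding M_def cyc by blast
  \<comment> \<open>A point of the circle differs from its centre, so the nonzero factor
    \<open>cx (X - c 1)\<close> cancels from the fixed point equation.\<close>
  have "X \<noteq> c 1"
    using circle[of 1] assms(6) by auto
  then have "M A = 1"
    using A assms(7) by (simp add: cx_eq_0_iff)
  moreover have "M B = cnj (M A)"
    unfolding M_def cnj_prod
  proof (rule prod.cong)
    fix i assume i: "i \<in> {1..n}"
    have "r i > 0 \<and> C i = sphere (c i) (r i)"
      "r (i + 1) > 0 \<and> C (i + 1) = sphere (c (i + 1)) (r (i + 1))"
      using i by (simp_all add: circle)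
    with i assms(5) have "r i > 0" "r (i + 1) > 0"
      "sphere (c i) (r i) \<inter> sphere (c (i + 1)) (r (i + 1)) = {A i, B i}"
      by metis+
    from conjugate_multipliers[OF this]
    show "cnj (cx (B i - c (i + 1)) / cx (B i - c i))
        = cnj (cnj (cx (A i - c (i + 1)) / cx (A i - c i)))"
      by simp
  qed simp
  ultimately have "cx (pivot_chain C B n Y - c 1) = cx (Y - c 1)"
    using B by simp
  then show "pivot_chain C B n Y = Y"
    by (simp add: cx_eq_iff)
qed

end
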